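(* Let $D$ be an integral domain and let $C$ be an ideal of $D$. Then $C$ is a coprime ideal if and only if $C$ is the least ideal of $D$.
   Context: All rings are commutative with identity. For ideals $I,J$ of a ring $A$, $\operatorname{Ann}(I)=\{a\in A\mid aI=0\}$ and $(J:I)=\{a\in A\mid aI\subseteq J\}$. The coproduct of $I$ and $J$ is the ideal $[I:J]:=(J:\operatorname{Ann}(I))=\{a\in A\mid a\operatorname{Ann}(I)\subseteq J\}$. An ideal $C$ of $A$ is coprime if $C\neq 0$ and, for all ideals $I,J$ of $A$, $C\subseteq [I:J]$ implies $C\subseteq I$ or $C\subseteq J$. A non-zero ideal $M$ of $A$ is called the least ideal of $A$ if $M\subseteq I$ for every non-zero ideal $I$ of $A$. *)

theory Defs
  imports "HOL-Algebra.Ideal"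
begin

definition annihilator :: "('a, 'b) ring_scheme \<Rightarrow> 'a set \<Rightarrow> 'a set"
  where "annihilator R I = {a \<in> carrier R. \<forall>x \<in> I. a \<otimes>\<^bsub>R\<^esub> x = \<zero>\<^bsub>R\<^esub>}"

text \<open>\<open>ideal_quotient R J I\<close> is the ideal written (J : I).\<close>

definition ideal_quotient :: "('a, 'b) ring_scheme \<Rightarrow> 'a set \<Rightarrow> 'a set \<Rightarrow> 'a set"
  where "ideal_quotient R J I = {a \<in> carrier R. \<forall>x \<in> I. a \<otimes>\<^bsub>R\<^esub> x \<in> J}"

text \<open>\<open>ideal_coproduct R I J\<close> is the ideal written [I : J] = (J : Ann(I)); note the order of the arguments.\<close>

definition ideal_coproduct :: "('a, 'b) ring_scheme \<Rightarrow> 'a set \<Rightarrow> 'a set \<Rightarrow> 'a set"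
  where "ideal_coproduct R I J = ideal_quotient R J (annihilator R I)"

definition coprime_ideal :: "('a, 'b) ring_scheme \<Rightarrow> 'a set \<Rightarrow> bool"
  where "coprime_ideal R C \<longleftrightarrow>
    ideal C R \<and> C \<noteq> {\<zero>\<^bsub>R\<^esub>} \<and>
    (\<forall>I J. ideal I R \<longrightarrow> ideal J R \<longrightarrow> C \<subseteq> ideal_coproduct R I J \<longrightarrow> C \<subseteq> I \<or> C \<subseteq> J)"

definition least_ideal :: "('a, 'b) ring_scheme \<Rightarrow> 'a set \<Rightarrow> bool"
  where "least_ideal R M \<longleftrightarrow>
    ideal M R \<and> M \<noteq> {\<zero>\<^bsub>R\<^esub>} \<and>
    (\<forall>I. ideal I R \<longrightarrow> I \<noteq> {\<zero>\<^bsub>R\<^esub>} \<longrightarrow> M \<subseteq> I)"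

end

(* In a domain, [I : J] is the whole ring if I is non-zero, and [0 : J] = J.  Testing coprimality
   on the pairs (I, 0) gives minimality of C; the converse is a case distinction on I = 0. *)
theory Submission
  imports Defs
begin

text \<open>Without zero divisors an annihilator is either zero or everything, so the coproduct
  degenerates (\<open>ideal_coproduct_nonzero\<close>, \<open>ideal_coproduct_zero\<close>). For
  non-zero \<open>I\<close> the hypothesis of coprimality then always holds, which forces
  \<open>C\<close> into \<open>I\<close> as soon as \<open>J\<close> is too small to contain
  \<open>C\<close>. For zero \<open>I\<close> that hypothesis is already the conclusion
  \<open>C \<subseteq> J\<close>.\<close>

lemma (in ring) annihilator_zero: "annihilator R {\<zero>} = carrier R"
  by (auto simp: annihilator_def)

lemma (in ring) ideal_ne_zeroE:
  assumes "ideal I R" and "I \<noteq> {\<zero>}"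
  obtains x where "x \<in> I" and "x \<in> carrier R" and "x \<noteq> \<zero>"
  using assms additive_subgroup.zero_closed[of I R] additive_subgroup.a_Hcarr[of I R]
  by (auto simp: ideal_def)

text \<open>A single non-zero \<open>x\<close> in \<open>I\<close> suffices:
  \<open>a \<otimes> x = \<zero>\<close> forces \<open>a = \<zero>\<close> by integrality.\<close>

lemma (in domain) annihilator_nonzero:
  assumes "ideal I R" and "I \<noteq> {\<zero>}"
  shows "annihilator R I = {\<zero>}"
proof -
  obtain x where x: "x \<in> I" "x \<in> carrier R" "x \<noteq> \<zero>"
    using assms by (rule ideal_ne_zeroE)
  have "a = \<zero>" if "a \<in> carrier R" "a \<otimes> x = \<zero>" for a
    using that x integral by blast
  moreover have "I \<subseteq> carrier R"
    using assms(1) by (simp add: additive_subgroup.a_subset ideal_def)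
  ultimately show ?thesis
    using x(1) by (auto simp: annihilator_def)
qed

text \<open>Since the annihilator is zero, the only condition on \<open>a\<close> is
  \<open>a \<otimes> \<zero> \<in> J\<close>.\<close>

lemma (in domain) ideal_coproduct_nonzero:
  assumes "ideal I R" and "I \<noteq> {\<zero>}" and "ideal J R"
  shows "ideal_coproduct R I J = carrier R"
  using assms additive_subgroup.zero_closed[of J R]
  by (auto simp: ideal_coproduct_def ideal_quotient_def annihilator_nonzero ideal_def)

text \<open>The annihilator of zero contains \<open>\<one>\<close>, and multiplying by it gives one
  inclusion; absorption in \<open>J\<close> gives the other.\<close>

lemma (in ring) ideal_coproduct_zero:
  assumes "ideal J R"
  shows "ideal_coproduct R {\<zero>} J = J"
proof
  show "ideal_coproduct R {\<zero>} J \<subseteq> J"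
  proof
    fix a assume "a \<in> ideal_coproduct R {\<zero>} J"
    then have "a \<in> carrier R" "a \<otimes> \<one> \<in> J"
      unfolding ideal_coproduct_def ideal_quotient_def annihilator_zero by blast+
    then show "a \<in> J" by simp
  qed
  show "J \<subseteq> ideal_coproduct R {\<zero>} J"
    using ideal.Icarr[OF assms] ideal.I_r_closed[OF assms]
    unfolding ideal_coproduct_def ideal_quotient_def annihilator_zero by blast
qed

theorem proposition11:
  fixes D :: "('a, 'b) ring_scheme" and C :: "'a set"
  assumes "domain D" and "ideal C D"
  shows "coprime_ideal D C \<longleftrightarrow> least_ideal D C"
proof -
  interpret domain D by fact
  have C: "C \<subseteq> carrier D" "\<zero>\<^bsub>D\<^esub> \<in> C"
    using assms(2) additive_subgroup.zero_closed[of C D]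
    by (auto simp: additive_subgroup.a_subset ideal_def)
  show ?thesis
  proof
    assume cop: "coprime_ideal D C"
    have "C \<subseteq> I" if I: "ideal I D" "I \<noteq> {\<zero>\<^bsub>D\<^esub>}" for I
    proof -
      \<comment> \<open>The choice of the zero ideal for \<open>J\<close> rules out the second
        alternative, because \<open>C\<close> is non-zero.\<close>
      have "C \<subseteq> ideal_coproduct D I {\<zero>\<^bsub>D\<^esub>}"
        using C(1) ideal_coproduct_nonzero[OF I zeroideal] by simp
      then have "C \<subseteq> I \<or> C \<subseteq> {\<zero>\<^bsub>D\<^esub>}"
        using cop I(1) zeroideal by (auto simp: coprime_ideal_def)
      then show ?thesis
        using cop C(2) by (auto simp: coprime_ideal_def)
    qed
    then show "least_ideal D C"
      using cop by (simp add: least_ideal_def coprime_ideal_def)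
  next
    assume least: "least_ideal D C"
    \<comment> \<open>For non-zero \<open>I\<close>, leastness gives \<open>C \<subseteq> I\<close>;
      for zero \<open>I\<close>, the coproduct is \<open>J\<close> itself.\<close>
    have "C \<subseteq> I \<or> C \<subseteq> J"
      if "ideal I D" "ideal J D" "C \<subseteq> ideal_coproduct D I J" for I J
      using that least ideal_coproduct_zero[of J]
      by (cases "I = {\<zero>\<^bsub>D\<^esub>}") (simp_all add: least_ideal_def)
    then show "coprime_ideal D C"
      using least by (simp add: least_ideal_def coprime_ideal_def)
  qed
qed

end
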